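(* Let $a<b$, $0\le\tau<b-a$, and let $L$ and $z$ be as described in the context. If $x$ is a generalized extremal with time delay such that $$ \partial_4L[x,z]_\tau(t+\tau)\cdot\dot x(t)+\partial_5L[x,z]_\tau(t+\tau)\cdot\ddot x(t)=0 $$ for all $t\in[a-\tau,b-\tau]$, then $x$ satisfies $$ \frac{d}{dt}\Bigl\{\lambda(t)L[x,z]_\tau(t)-\dot x(t)\bigl[\lambda(t)\partial_3L[x,z]_\tau(t)+\lambda(t+\tau)\partial_5L[x,z]_\tau(t+\tau)\bigr]\Bigr\}=\lambda(t)\,\partial_1L[x,z]_\tau(t) $$ for $a\le t\le b-\tau$, and $$ \frac{d}{dt}\Bigl\{\lambda(t)\bigl[L[x,z]_\tau(t)-\dot x(t)\,\partial_3L[x,z]_\tau(t)\bigr]\Bigr\}=\lambda(t)\,\partial_1L[x,z]_\tau(t) $$ for $b-\tau\le t\le b$.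
   Context: Notation: $\partial_iL$ is the partial derivative of $L$ with respect to its $i$th argument; $[x,z]_\tau(t):=(t,x(t),\dot x(t),x(t-\tau),\dot x(t-\tau),z(t))$, and $L[x,z]_\tau(t)$, $\partial_iL[x,z]_\tau(t)$ denote evaluation at this point; $\lambda(t):=e^{-\int_a^t\partial_6L[x,z]_\tau(\theta)\,d\theta}$. For $x\in C^2([a-\tau,b],\mathbb{R})$, $z$ denotes the solution on $[a,b]$ of $$\dot z(t)=L\bigl(t,x(t),\dot x(t),x(t-\tau),\dot x(t-\tau),z(t)\bigr),\quad t\in[a,b],\qquad z(a)=\gamma,$$ where $\gamma$ is a fixed real number. Given a fixed real number $\beta$ and a given $\delta\in C^2([a-\tau,a],\mathbb{R})$, a function $x\in C^2([a-\tau,b],\mathbb{R})$ is admissible if $x(b)=\beta$ and $x(t)=\delta(t)$ for $t\in[a-\tau,a]$. The Lagrangian $L$ is assumed to satisfy: (i) $L\in C^1([a,b]\times\mathbb{R}^5,\mathbb{R})$; (ii) for $i=2,\dots,6$ the function $t\mapsto\partial_iL[x,z]_\tau(t)$ is differentiable for any admissible trajectory $x$. A generalized extremal with time delay is a function $x\in C^2([a-\tau,b],\mathbb{R})$ that solves the generalized Euler--Lagrange equations $$ \lambda(t+\tau)\Bigl[\partial_4L[x,z]_\tau(t+\tau)-\frac{d}{dt}\partial_5L[x,z]_\tau(t+\tau)+\partial_5L[x,z]_\tau(t+\tau)\,\partial_6L[x,z]_\tau(t+\tau)\Bigr] $$ $$ +\lambda(t)\Bigl[\partial_2L[x,z]_\tau(t)-\frac{d}{dt}\partial_3L[x,z]_\tau(t)+\partial_3L[x,z]_\tau(t)\,\partial_6L[x,z]_\tau(t)\Bigr]=0,\qquad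 a\le t\le b-\tau, $$ and $$ \partial_2L[x,z]_\tau(t)-\frac{d}{dt}\partial_3L[x,z]_\tau(t)+\partial_3L[x,z]_\tau(t)\,\partial_6L[x,z]_\tau(t)=0,\qquad b-\tau\le t\le b. $$ *)

theory Defs
  imports "HOL-Analysis.Analysis"
begin

text \<open>Every derivative below is a derivative relative to the interval on which the function in
  question is defined, hence one-sided at the endpoints of that interval and two-sided inside.\<close>

definition C2_on :: "real set \<Rightarrow> (real \<Rightarrow> real) \<Rightarrow> bool" where
  "C2_on S f \<longleftrightarrow> (\<exists>f' f''.
     (\<forall>t\<in>S. (f has_real_derivative f' t) (at t within S)) \<and>
     (\<forall>t\<in>S. (f' has_real_derivative f'' t) (at t within S)) \<and>
     continuous_on S f'')"

definition C1_on :: "'a::euclidean_space set \<Rightarrow> ('a \<Rightarrow> real) \<Rightarrow> bool" where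
  "C1_on S f \<longleftrightarrow> (\<exists>f' :: 'a \<Rightarrow> 'a \<Rightarrow>\<^sub>L real.
     (\<forall>p\<in>S. (f has_derivative blinfun_apply (f' p)) (at p within S)) \<and> continuous_on S f')"

text \<open>The six arguments of the Lagrangian are the coordinates of a vector in
  \<^typ>\<open>real^6\<close>. The index type \<^typ>\<open>6\<close> is the integers modulo 6, so the numerals 1, ..., 6
  are its six distinct elements (the last one coinciding with 0).\<close>

definition lag_dom :: "real \<Rightarrow> real \<Rightarrow> (real^6) set" where
  "lag_dom a b = {p. p $ 1 \<in> {a..b}}"

definition replace_arg :: "6 \<Rightarrow> real \<Rightarrow> real^6 \<Rightarrow> real^6" where
  "replace_arg i s p = (\<chi> j. if j = i then s else p $ j)"

definition partial_deriv :: "real \<Rightarrow> real \<Rightarrow> 6 \<Rightarrow> (real^6 \<Rightarrow> real) \<Rightarrow> real^6 \<Rightarrow> real" where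
  "partial_deriv a b i L p =
     vector_derivative (\<lambda>s. L (replace_arg i s p))
       (at (p $ i) within {s. replace_arg i s p \<in> lag_dom a b})"

definition xdot :: "real \<Rightarrow> real \<Rightarrow> real \<Rightarrow> (real \<Rightarrow> real) \<Rightarrow> real \<Rightarrow> real" where
  "xdot a b \<tau> x t = vector_derivative x (at t within {a-\<tau>..b})"

definition xddot :: "real \<Rightarrow> real \<Rightarrow> real \<Rightarrow> (real \<Rightarrow> real) \<Rightarrow> real \<Rightarrow> real" where
  "xddot a b \<tau> x t = vector_derivative (xdot a b \<tau> x) (at t within {a-\<tau>..b})"

definition bracket ::
  "real \<Rightarrow> real \<Rightarrow> real \<Rightarrow> (real \<Rightarrow> real) \<Rightarrow> (real \<Rightarrow> real) \<Rightarrow> real \<Rightarrow> real^6" where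
  "bracket a b \<tau> x z t =
     vector [t, x t, xdot a b \<tau> x t, x (t - \<tau>), xdot a b \<tau> x (t - \<tau>), z t]"

definition Lalong :: "real \<Rightarrow> real \<Rightarrow> real \<Rightarrow> (real^6 \<Rightarrow> real) \<Rightarrow>
    (real \<Rightarrow> real) \<Rightarrow> (real \<Rightarrow> real) \<Rightarrow> real \<Rightarrow> real" where
  "Lalong a b \<tau> L x z t = L (bracket a b \<tau> x z t)"

definition dLalong :: "real \<Rightarrow> real \<Rightarrow> real \<Rightarrow> (real^6 \<Rightarrow> real) \<Rightarrow>
    (real \<Rightarrow> real) \<Rightarrow> (real \<Rightarrow> real) \<Rightarrow> 6 \<Rightarrow> real \<Rightarrow> real" where
  "dLalong a b \<tau> L x z i t = partial_deriv a b i L (bracket a b \<tau> x z t)"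

definition lam :: "real \<Rightarrow> real \<Rightarrow> real \<Rightarrow> (real^6 \<Rightarrow> real) \<Rightarrow>
    (real \<Rightarrow> real) \<Rightarrow> (real \<Rightarrow> real) \<Rightarrow> real \<Rightarrow> real" where
  "lam a b \<tau> L x z t = exp (- integral {a..t} (\<lambda>\<theta>. dLalong a b \<tau> L x z 6 \<theta>))"

definition z_solution :: "real \<Rightarrow> real \<Rightarrow> real \<Rightarrow> real \<Rightarrow> (real^6 \<Rightarrow> real) \<Rightarrow>
    (real \<Rightarrow> real) \<Rightarrow> (real \<Rightarrow> real) \<Rightarrow> bool" where
  "z_solution a b \<tau> \<gamma> L x z \<longleftrightarrow>
     (\<forall>t\<in>{a..b}. (z has_real_derivative Lalong a b \<tau> L x z t) (at t within {a..b})) \<and> z a = \<gamma>"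

definition admissible :: "real \<Rightarrow> real \<Rightarrow> real \<Rightarrow> real \<Rightarrow> (real \<Rightarrow> real) \<Rightarrow> (real \<Rightarrow> real) \<Rightarrow> bool" where
  "admissible a b \<tau> \<beta> \<delta> x \<longleftrightarrow>
     C2_on {a-\<tau>..b} x \<and> x b = \<beta> \<and> (\<forall>t\<in>{a-\<tau>..a}. x t = \<delta> t)"

definition lagrangian :: "real \<Rightarrow> real \<Rightarrow> real \<Rightarrow> real \<Rightarrow> real \<Rightarrow> (real \<Rightarrow> real) \<Rightarrow>
    (real^6 \<Rightarrow> real) \<Rightarrow> bool" where
  "lagrangian a b \<tau> \<beta> \<gamma> \<delta> L \<longleftrightarrow>
     C1_on (lag_dom a b) L \<and>
     (\<forall>x z. admissible a b \<tau> \<beta> \<delta> x \<longrightarrow> z_solution a b \<tau> \<gamma> L x z \<longrightarrow>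
        (\<forall>i\<in>{2,3,4,5,6}. dLalong a b \<tau> L x z i differentiable_on {a..b}))"

text \<open>An extremal need not be admissible, so the regularity clause in \<^const>\<open>lagrangian\<close> does not
  apply to it; the existence of the derivatives in the Euler--Lagrange equations is part of
  being a solution. The shifted function, whose derivative is \<open>D5\<close>, has
  domain \<open>{a-\<tau>..b-\<tau>}\<close>.\<close>

definition generalized_extremal :: "real \<Rightarrow> real \<Rightarrow> real \<Rightarrow> (real^6 \<Rightarrow> real) \<Rightarrow>
    (real \<Rightarrow> real) \<Rightarrow> (real \<Rightarrow> real) \<Rightarrow> bool" where
  "generalized_extremal a b \<tau> L x z \<longleftrightarrow>
     C2_on {a-\<tau>..b} x \<and>
     (let dL = dLalong a b \<tau> L x z; lm = lam a b \<tau> L x z in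
      (\<forall>t\<in>{a..b-\<tau>}. \<exists>D3 D5.
         (dL 3 has_real_derivative D3) (at t within {a..b}) \<and>
         ((\<lambda>s. dL 5 (s + \<tau>)) has_real_derivative D5) (at t within {a-\<tau>..b-\<tau>}) \<and>
         lm (t + \<tau>) * (dL 4 (t + \<tau>) - D5 + dL 5 (t + \<tau>) * dL 6 (t + \<tau>))
           + lm t * (dL 2 t - D3 + dL 3 t * dL 6 t) = 0) \<and>
      (\<forall>t\<in>{b-\<tau>..b}. \<exists>D3.
         (dL 3 has_real_derivative D3) (at t within {a..b}) \<and>
         dL 2 t - D3 + dL 3 t * dL 6 t = 0))"

end

theory Submission
  imports Defs
begin

text \<open>By the chain rule the derivative of \<open>L[x,z]\<^sub>\<tau>\<close> has the delayed contribution
  \<open>\<partial>\<^sub>4L \<cdot> x'(t - \<tau>) + \<partial>\<^sub>5L \<cdot> x''(t - \<tau>)\<close>, which the hypothesis annihilates, and the contribution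
  \<open>\<partial>\<^sub>6L \<cdot> L\<close>, which \<open>\<lambda>' = - \<lambda> \<cdot> \<partial>\<^sub>6L\<close> cancels. In the remaining terms the Euler--Lagrange equation
  is multiplied by \<open>x'\<close>; on \<open>[a, b - \<tau>]\<close> the hypothesis is used once more, at the advanced time.\<close>

lemma exhaust_6: "x = 1 \<or> x = 2 \<or> x = 3 \<or> x = 4 \<or> x = 5 \<or> x = 6" for x :: 6
proof (induct x)
  case (of_int z)
  then have "0 \<le> z" and "z < 6" by simp_all
  then have "z = 0 \<or> z = 1 \<or> z = 2 \<or> z = 3 \<or> z = 4 \<or> z = 5" by arith
  \<comment> \<open>The residue 0 is the index written \<open>6\<close>; the other residues carry
    their own names.\<close>
  then show ?case by auto
qed

lemma UNIV_6: "(UNIV :: 6 set) = {1, 2, 3, 4, 5, 6}"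
  using exhaust_6 by auto

lemma sum_6: "sum f (UNIV :: 6 set) = f 1 + f 2 + f 3 + f 4 + f 5 + f 6"
  unfolding UNIV_6 by (simp add: ac_simps)

lemma vector_6 [simp]:
  "(vector [p, q, r, s, u, v] :: ('a::zero)^6) $ 1 = p"
  "(vector [p, q, r, s, u, v] :: ('a::zero)^6) $ 2 = q"
  "(vector [p, q, r, s, u, v] :: ('a::zero)^6) $ 3 = r"
  "(vector [p, q, r, s, u, v] :: ('a::zero)^6) $ 4 = s"
  "(vector [p, q, r, s, u, v] :: ('a::zero)^6) $ 5 = u"
  "(vector [p, q, r, s, u, v] :: ('a::zero)^6) $ 6 = v"
  unfolding vector_def by simp_all

text \<open>The Euclidean basis consists of the vectors \<open>axis i 1\<close>, and the inner
  product with such a vector picks out a coordinate, so differentiability can be tested coordinate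
  by coordinate.\<close>

lemma has_vector_derivative_vec:
  fixes f :: "real \<Rightarrow> real^'n"
  assumes "\<And>i. ((\<lambda>t. f t $ i) has_real_derivative g $ i) (at t within S)"
  shows "(f has_vector_derivative g) (at t within S)"
  unfolding has_vector_derivative_def has_derivative_componentwise_within[of f]
  using assms
  by (auto simp: Basis_vec_def inner_axis has_field_derivative_def mult_commute_abs)

text \<open>The slice through \<open>p\<close> in direction \<open>i\<close> is an affine curve with
  velocity \<open>axis i 1\<close>, so the chain rule applies. This ties the partial derivatives,
  defined by a choice operator, to the total derivative relative to the domain.\<close>

lemma partial_deriv_eq:
  assumes "a < b" and p: "p \<in> lag_dom a b"
    and L: "(L has_derivative L') (at p within lag_dom a b)"
  shows "partial_deriv a b i L p = L' (axis i 1)"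
proof -
  define S where "S = {s. replace_arg i s p \<in> lag_dom a b}"
  \<comment> \<open>The domain constrains only the time coordinate.\<close>
  have S: "S = (if i = 1 then {a..b} else UNIV)"
    using p by (auto simp: S_def lag_dom_def replace_arg_def)
  \<comment> \<open>Needed for uniqueness of the derivative on the slice; for \<open>i = 1\<close>
    this is where \<open>a < b\<close> enters.\<close>
  have nontriv: "at (p $ i) within S \<noteq> bot"
    using p \<open>a < b\<close> by (auto simp: S trivial_limit_within islimpt_Icc lag_dom_def)
  have at_p: "replace_arg i (p $ i) p = p"
    by (simp add: replace_arg_def vec_eq_iff)
  have "((\<lambda>s. replace_arg i s p) has_vector_derivative axis i 1) (at (p $ i) within S)"
    by (rule has_vector_derivative_vec)
      (auto simp: replace_arg_def axis_def intro!: derivative_eq_intros)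
  then have "((\<lambda>s. L (replace_arg i s p)) has_derivative (\<lambda>h. L' (h *\<^sub>R axis i 1)))
      (at (p $ i) within S)"
    unfolding has_vector_derivative_def
  proof (rule has_derivative_in_compose)
    show "(L has_derivative L')
        (at (replace_arg i (p $ i) p) within (\<lambda>s. replace_arg i s p) ` S)"
      unfolding at_p by (rule has_derivative_subset[OF L]) (auto simp: S_def)
  qed
  then have "((\<lambda>s. L (replace_arg i s p)) has_vector_derivative L' (axis i 1))
      (at (p $ i) within S)"
    by (simp add: has_vector_derivative_def
        linear_scale[OF bounded_linear.linear[OF has_derivative_bounded_linear[OF L]]])
  with nontriv show ?thesis
    unfolding partial_deriv_def S_def[symmetric] by (rule vector_derivative_within)
qed

text \<open>Derivatives on a nondegenerate interval are unique, so the witnesses supplied by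
  \<open>C2_on\<close> agree there with the chosen values \<open>xdot\<close> and
  \<open>xddot\<close>.\<close>

lemma has_derivative_xdot_xddot:
  assumes "C2_on {a-\<tau>..b} x" and "a - \<tau> < b" and t: "t \<in> {a-\<tau>..b}"
  shows "(x has_real_derivative xdot a b \<tau> x t) (at t within {a-\<tau>..b})" (is ?xdot)
    and "(xdot a b \<tau> x has_real_derivative xddot a b \<tau> x t) (at t within {a-\<tau>..b})" (is ?xddot)
proof -
  obtain f' f'' where
    f': "\<And>t. t \<in> {a-\<tau>..b} \<Longrightarrow> (x has_real_derivative f' t) (at t within {a-\<tau>..b})" and
    f'': "\<And>t. t \<in> {a-\<tau>..b} \<Longrightarrow> (f' has_real_derivative f'' t) (at t within {a-\<tau>..b})"
    using assms(1) unfolding C2_on_def by blast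
  have xdot: "xdot a b \<tau> x s = f' s" if "s \<in> {a-\<tau>..b}" for s
    unfolding xdot_def
    using f'[OF that] that \<open>a - \<tau> < b\<close>
    by (intro vector_derivative_within_closed_interval)
      (auto simp: has_real_derivative_iff_has_vector_derivative)
  show ?xdot
    using f'[OF t] xdot[OF t] by simp
  \<comment> \<open>\<open>xdot\<close> and \<open>f'\<close> are known to agree only on the
    interval, which suffices for a derivative relative to it.\<close>
  have deriv: "(xdot a b \<tau> x has_real_derivative f'' t) (at t within {a-\<tau>..b})"
    using has_derivative_transform[OF t xdot] f''[OF t] by (simp add: has_field_derivative_def)
  then have "xddot a b \<tau> x t = f'' t"
    unfolding xddot_def
    using t \<open>a - \<tau> < b\<close>
    by (intro vector_derivative_within_closed_interval)
      (auto simp: has_real_derivative_iff_has_vector_derivative)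
  with deriv show ?xddot
    by simp
qed

text \<open>Chain rule for a translation, with separate domains \<open>S\<close> and
  \<open>T\<close> so that one-sided derivatives carry over. It serves the delay with
  \<open>c = -\<tau>\<close> and the advance with \<open>c = \<tau>\<close>.\<close>

lemma has_real_derivative_shift:
  fixes f :: "real \<Rightarrow> real"
  assumes "(f has_real_derivative D) (at (t + c) within T)"
    and "(\<lambda>s. s + c) ` S \<subseteq> T"
  shows "((\<lambda>s. f (s + c)) has_real_derivative D) (at t within S)"
proof -
  have "((\<lambda>s. s + c) has_real_derivative 1) (at t within S)"
    by (auto intro!: derivative_eq_intros)
  from DERIV_image_chain[OF DERIV_subset[OF assms] this] show ?thesis
    by (simp add: o_def)
qed

lemma bracket_in_lag_dom: "bracket a b \<tau> x z t \<in> lag_dom a b \<longleftrightarrow> t \<in> {a..b}"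
  by (simp add: bracket_def lag_dom_def)

text \<open>The last entry comes from the differential equation for \<open>z\<close>, whose velocity
  is the Lagrangian itself. The delayed entries exist because \<open>t - \<tau>\<close> stays in
  \<open>{a-\<tau>..b}\<close>.\<close>

lemma bracket_has_vector_derivative:
  assumes "a < b" and "0 \<le> \<tau>" and x: "C2_on {a-\<tau>..b} x"
    and z: "z_solution a b \<tau> \<gamma> L x z" and t: "t \<in> {a..b}"
  shows "(bracket a b \<tau> x z has_vector_derivative
      vector [1, xdot a b \<tau> x t, xddot a b \<tau> x t, xdot a b \<tau> x (t - \<tau>), xddot a b \<tau> x (t - \<tau>),
        Lalong a b \<tau> L x z t]) (at t within {a..b})"
proof (rule has_vector_derivative_vec)
  fix i :: 6
  have "a - \<tau> < b" using assms by simp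
  note deriv = has_derivative_xdot_xddot[OF x this]
  have "(x has_real_derivative xdot a b \<tau> x t) (at t within {a..b})"
    "(xdot a b \<tau> x has_real_derivative xddot a b \<tau> x t) (at t within {a..b})"
    using t \<open>0 \<le> \<tau>\<close> by (auto intro: DERIV_subset[OF deriv(1)] DERIV_subset[OF deriv(2)])
  moreover have
    "((\<lambda>s. x (s + - \<tau>)) has_real_derivative xdot a b \<tau> x (t - \<tau>)) (at t within {a..b})"
    "((\<lambda>s. xdot a b \<tau> x (s + - \<tau>)) has_real_derivative xddot a b \<tau> x (t - \<tau>)) (at t within {a..b})"
    by (rule has_real_derivative_shift[where T = "{a-\<tau>..b}"];
        use t \<open>0 \<le> \<tau>\<close> deriv[of "t - \<tau>"] in auto)+
  moreover have "(z has_real_derivative Lalong a b \<tau> L x z t) (at t within {a..b})"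
    using z t by (simp add: z_solution_def)
  ultimately show "((\<lambda>t. bracket a b \<tau> x z t $ i) has_real_derivative
      vector [1, xdot a b \<tau> x t, xddot a b \<tau> x t, xdot a b \<tau> x (t - \<tau>), xddot a b \<tau> x (t - \<tau>),
        Lalong a b \<tau> L x z t] $ i) (at t within {a..b})"
    using exhaust_6[of i] by (auto simp: bracket_def)
qed

lemma Lalong_has_real_derivative:
  assumes "a < b" and "0 \<le> \<tau>" and x: "C2_on {a-\<tau>..b} x" and L: "C1_on (lag_dom a b) L"
    and z: "z_solution a b \<tau> \<gamma> L x z" and t: "t \<in> {a..b}"
  shows "(Lalong a b \<tau> L x z has_real_derivative
      dLalong a b \<tau> L x z 1 t
      + dLalong a b \<tau> L x z 2 t * xdot a b \<tau> x t
      + dLalong a b \<tau> L x z 3 t * xddot a b \<tau> x t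
      + dLalong a b \<tau> L x z 4 t * xdot a b \<tau> x (t - \<tau>)
      + dLalong a b \<tau> L x z 5 t * xddot a b \<tau> x (t - \<tau>)
      + dLalong a b \<tau> L x z 6 t * Lalong a b \<tau> L x z t) (at t within {a..b})"
proof -
  define p where "p = bracket a b \<tau> x z t"
  define v :: "real^6" where "v = vector [1, xdot a b \<tau> x t, xddot a b \<tau> x t,
    xdot a b \<tau> x (t - \<tau>), xddot a b \<tau> x (t - \<tau>), Lalong a b \<tau> L x z t]"
  have p: "p \<in> lag_dom a b"
    using t by (simp add: p_def bracket_in_lag_dom)
  obtain L' where L': "(L has_derivative L') (at p within lag_dom a b)"
    using L p unfolding C1_on_def by blast
  interpret L': bounded_linear L'
    by (rule has_derivative_bounded_linear[OF L'])
  have "(bracket a b \<tau> x z has_derivative (\<lambda>h. h *\<^sub>R v)) (at t within {a..b})"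
    using bracket_has_vector_derivative[OF assms(1,2) x z t]
    by (simp add: has_vector_derivative_def v_def)
  then have "((\<lambda>s. L (bracket a b \<tau> x z s)) has_derivative (\<lambda>h. L' (h *\<^sub>R v))) (at t within {a..b})"
    by (rule has_derivative_in_compose)
      (fold p_def, rule has_derivative_subset[OF L'], auto simp: bracket_in_lag_dom)
  then have "(Lalong a b \<tau> L x z has_real_derivative L' v) (at t within {a..b})"
    by (simp add: Lalong_def[abs_def] has_field_derivative_def L'.scale mult_commute_abs)
  \<comment> \<open>Expanding the velocity in the standard basis turns the total derivative into a
    sum of partial derivatives.\<close>
  also have "L' v = L' (\<Sum>i\<in>UNIV. v $ i *\<^sub>R axis i 1)"
    using basis_expansion[of v] by (simp add: scalar_mult_eq_scaleR)
  also have "\<dots> = (\<Sum>i\<in>UNIV. dLalong a b \<tau> L x z i t * v $ i)"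
    using partial_deriv_eq[OF \<open>a < b\<close> p L']
    by (simp add: L'.sum L'.scale dLalong_def p_def mult.commute)
  finally show ?thesis
    by (simp add: sum_6 v_def)
qed

text \<open>The partial derivative along the curve is the continuous derivative of \<open>L\<close>,
  composed with the continuous \<open>bracket\<close> and applied to the fixed vector
  \<open>axis i 1\<close>. The case \<open>i = 6\<close> makes the integral in \<open>lam\<close>
  differentiable.\<close>

lemma continuous_on_dLalong:
  assumes "a < b" and "0 \<le> \<tau>" and x: "C2_on {a-\<tau>..b} x" and L: "C1_on (lag_dom a b) L"
    and z: "z_solution a b \<tau> \<gamma> L x z"
  shows "continuous_on {a..b} (dLalong a b \<tau> L x z i)"
proof -
  obtain L' where
    L': "\<And>p. p \<in> lag_dom a b \<Longrightarrow> (L has_derivative blinfun_apply (L' p)) (at p within lag_dom a b)"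
    and cont: "continuous_on (lag_dom a b) L'"
    using L unfolding C1_on_def by blast
  have "continuous_on {a..b} (bracket a b \<tau> x z)"
    using bracket_has_vector_derivative[OF assms(1,2) x z]
    by (rule continuous_on_vector_derivative)
  then have "continuous_on {a..b} (\<lambda>t. L' (bracket a b \<tau> x z t))"
    by (rule continuous_on_compose2[OF cont]) (auto simp: bracket_in_lag_dom)
  then have "continuous_on {a..b} (\<lambda>t. blinfun_apply (L' (bracket a b \<tau> x z t)) (axis i 1))"
    by (intro continuous_intros)
  then show ?thesis
    by (rule continuous_on_eq)
      (simp add: dLalong_def partial_deriv_eq[OF \<open>a < b\<close> _ L'] bracket_in_lag_dom)
qed

text \<open>Fundamental theorem of calculus for the exponent, followed by the chain rule for
  \<open>exp\<close>.\<close>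

lemma lam_has_real_derivative:
  assumes "continuous_on {a..b} (dLalong a b \<tau> L x z 6)" and "t \<in> {a..b}"
  shows "(lam a b \<tau> L x z has_real_derivative - lam a b \<tau> L x z t * dLalong a b \<tau> L x z 6 t)
    (at t within {a..b})"
  unfolding lam_def[abs_def]
  by (rule derivative_eq_intros integral_has_real_derivative[OF assms] refl)+ simp

theorem theorem3p5:
  fixes a b \<tau> \<beta> \<gamma> :: real
    and \<delta> x z :: "real \<Rightarrow> real"
    and L :: "real^6 \<Rightarrow> real"
  assumes "a < b" and "0 \<le> \<tau>" and "\<tau> < b - a"
    and "C2_on {a-\<tau>..a} \<delta>"
    and "lagrangian a b \<tau> \<beta> \<gamma> \<delta> L"
    and "z_solution a b \<tau> \<gamma> L x z"
    and "generalized_extremal a b \<tau> L x z"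
    and "\<forall>t\<in>{a-\<tau>..b-\<tau>}.
           dLalong a b \<tau> L x z 4 (t + \<tau>) * xdot a b \<tau> x t
             + dLalong a b \<tau> L x z 5 (t + \<tau>) * xddot a b \<tau> x t = 0"
  shows "(\<forall>t\<in>{a..b-\<tau>}.
            ((\<lambda>s. lam a b \<tau> L x z s * Lalong a b \<tau> L x z s
                  - xdot a b \<tau> x s *
                      (lam a b \<tau> L x z s * dLalong a b \<tau> L x z 3 s
                       + lam a b \<tau> L x z (s + \<tau>) * dLalong a b \<tau> L x z 5 (s + \<tau>)))
             has_real_derivative lam a b \<tau> L x z t * dLalong a b \<tau> L x z 1 t)
            (at t within {a..b-\<tau>}))
       \<and> (\<forall>t\<in>{b-\<tau>..b}.
            ((\<lambda>s. lam a b \<tau> L x z s *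
                  (Lalong a b \<tau> L x z s - xdot a b \<tau> x s * dLalong a b \<tau> L x z 3 s))
             has_real_derivative lam a b \<tau> L x z t * dLalong a b \<tau> L x z 1 t)
            (at t within {a..b}))"
proof (intro conjI ballI)
  have x: "C2_on {a-\<tau>..b} x"
    using assms(7) by (simp add: generalized_extremal_def)
  have L: "C1_on (lag_dom a b) L"
    using assms(5) by (simp add: lagrangian_def)
  let ?xd = "xdot a b \<tau> x" and ?xdd = "xddot a b \<tau> x"
  let ?d = "dLalong a b \<tau> L x z" and ?l = "lam a b \<tau> L x z" and ?L = "Lalong a b \<tau> L x z"
  have lam: "(?l has_real_derivative - ?l t * ?d 6 t) (at t within {a..b})" if "t \<in> {a..b}" for t
    using continuous_on_dLalong[OF assms(1,2) x L assms(6)] that by (rule lam_has_real_derivative)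
  have xdot: "(?xd has_real_derivative ?xdd t) (at t within {a..b})" if "t \<in> {a..b}" for t
    using that assms(1,2) by (auto intro: DERIV_subset[OF has_derivative_xdot_xddot(2)[OF x]])
  have Lalong: "(?L has_real_derivative ?d 1 t + ?d 2 t * ?xd t + ?d 3 t * ?xdd t + ?d 6 t * ?L t)
      (at t within {a..b})" if "t \<in> {a..b}" for t
  proof -
    \<comment> \<open>As \<open>t\<close> runs over \<open>{a..b}\<close>, the time
      \<open>t - \<tau>\<close> runs over exactly the interval \<open>{a-\<tau>..b-\<tau>}\<close>
      of the hypothesis.\<close>
    have "?d 4 t * ?xd (t - \<tau>) + ?d 5 t * ?xdd (t - \<tau>) = 0"
      using assms(8)[rule_format, of "t - \<tau>"] that by simp
    with Lalong_has_real_derivative[OF assms(1,2) x L assms(6) that] show ?thesis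
      by (simp add: add.assoc)
  qed

  show "((\<lambda>s. ?l s * (?L s - ?xd s * ?d 3 s)) has_real_derivative ?l t * ?d 1 t)
      (at t within {a..b})" if late: "t \<in> {b-\<tau>..b}" for t
  proof -
    have t: "t \<in> {a..b}"
      using late assms(3) by auto
    obtain D3 where D3: "(?d 3 has_real_derivative D3) (at t within {a..b})"
      and EL: "?d 2 t - D3 + ?d 3 t * ?d 6 t = 0"
      using assms(7) late unfolding generalized_extremal_def Let_def by blast
    have D3_eq: "D3 = ?d 2 t + ?d 3 t * ?d 6 t"
      using EL by simp
    \<comment> \<open>In the product rule the terms \<open>?d 3 t * ?xdd t\<close> and
      \<open>?d 6 t * ?L t\<close> cancel. What remains is \<open>?l t * ?d 1 t\<close> plus
      \<open>?l t * ?xd t\<close> times the left side of \<open>EL\<close>.\<close>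
    from DERIV_mult[OF lam[OF t] DERIV_diff[OF Lalong[OF t] DERIV_mult[OF xdot[OF t] D3]]]
    show ?thesis
      by (rule DERIV_cong) (simp add: D3_eq algebra_simps)
  qed

  show "((\<lambda>s. ?l s * ?L s - ?xd s * (?l s * ?d 3 s + ?l (s + \<tau>) * ?d 5 (s + \<tau>)))
      has_real_derivative ?l t * ?d 1 t) (at t within {a..b-\<tau>})" if early: "t \<in> {a..b-\<tau>}" for t
  proof -
    \<comment> \<open>Both the present and the advanced time lie in \<open>{a..b}\<close>, so the
      derivative of \<open>lam\<close> is available at each; all derivatives are then restricted to
      \<open>{a..b-\<tau>}\<close>.\<close>
    have t: "t \<in> {a..b}" and t': "t + \<tau> \<in> {a..b}" and sub: "{a..b-\<tau>} \<subseteq> {a..b}"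
      using early assms(2) by auto
    obtain D3 D5 where D3: "(?d 3 has_real_derivative D3) (at t within {a..b})"
      and D5: "((\<lambda>s. ?d 5 (s + \<tau>)) has_real_derivative D5) (at t within {a-\<tau>..b-\<tau>})"
      and EL: "?l (t + \<tau>) * (?d 4 (t + \<tau>) - D5 + ?d 5 (t + \<tau>) * ?d 6 (t + \<tau>))
        + ?l t * (?d 2 t - D3 + ?d 3 t * ?d 6 t) = 0"
      using assms(7) early unfolding generalized_extremal_def Let_def by blast
    have D5': "((\<lambda>s. ?d 5 (s + \<tau>)) has_real_derivative D5) (at t within {a..b-\<tau>})"
      using assms(2) by (auto intro: DERIV_subset[OF D5])
    have lam': "((\<lambda>s. ?l (s + \<tau>)) has_real_derivative - ?l (t + \<tau>) * ?d 6 (t + \<tau>))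
        (at t within {a..b-\<tau>})"
      using assms(2) by (intro has_real_derivative_shift[OF lam[OF t']]) auto
    have delay: "?d 4 (t + \<tau>) * ?xd t + ?d 5 (t + \<tau>) * ?xdd t = 0"
      using assms(8) early assms(2) by auto
    note restrict = DERIV_subset[OF _ sub]
    \<comment> \<open>Both sides vanish, the left by \<open>EL\<close> and the right by
      \<open>delay\<close>. Their difference, left minus right, is exactly the excess of the
      product-rule derivative over \<open>?l t * ?d 1 t\<close>: the terms in
      \<open>?d 4 (t + \<tau>)\<close> cancel, and the right side supplies the one with
      \<open>?xdd t\<close>.\<close>
    have "?xd t * (?l (t + \<tau>) * (?d 4 (t + \<tau>) - D5 + ?d 5 (t + \<tau>) * ?d 6 (t + \<tau>))
        + ?l t * (?d 2 t - D3 + ?d 3 t * ?d 6 t))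
      = ?l (t + \<tau>) * (?d 4 (t + \<tau>) * ?xd t + ?d 5 (t + \<tau>) * ?xdd t)"
      unfolding EL delay by simp
    with DERIV_diff[OF
        DERIV_mult[OF restrict[OF lam[OF t]] restrict[OF Lalong[OF t]]]
        DERIV_mult[OF restrict[OF xdot[OF t]] DERIV_add[OF
          DERIV_mult[OF restrict[OF lam[OF t]] restrict[OF D3]] DERIV_mult[OF lam' D5']]]]
    show ?thesis
      by (elim DERIV_cong) (simp add: algebra_simps)
  qed
qed

end
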